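(* A vortex nerve with $k>1$ cycles contains $k-1$ ribbons.
   Context: A filled cycle $\mathrm{cyc}\,A$ in a planar CW complex (cells are vertices, edges and filled triangles) is the part of the plane consisting of a simple closed curve (containing a finite, nonempty, path-connected collection of vertices) together with everything inside it; $\mathrm{cl}$, $\mathrm{int}$ denote closure and interior. Two filled cycles are nesting if one of them is contained entirely in the interior of the other. A vortex nerve is a nonempty collection of pairwise nesting (usually non-concentric) filled cycles, in a finite planar CW complex, whose common intersection is nonempty, with zero or more edges (filaments) attached between pairs of its cycles. Given nesting filled cycles $\mathrm{cyc}\,A,\mathrm{cyc}\,B$ with $\mathrm{cyc}\,B$ in the interior of $\mathrm{cyc}\,A$, the associated planar ribbon is $\mathrm{cl}(\mathrm{cyc}\,A)\setminus\mathrm{int}(\mathrm{cyc}\,B)$. The ribbons contained in a vortex nerve are those determined by pairs of cycles of the nerve that are closest to each other, i.e. consecutive when the cycles are ordered by inclusion; thus the outer boundary of one ribbon is the inner boundary of the next. *)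

theory Defs
  imports "HOL-Analysis.Analysis"
begin

text \<open>
  A planar cell complex is recorded by its vertices, its open edges and the interiors of its
  filled triangles, all in the plane, represented by type \<^typ>\<open>complex\<close>.
\<close>

record cell_complex =
  verts :: "complex set"
  edges :: "complex set set"
  triangles :: "complex set set"

text \<open>
  As in any CW complex, edges may be curved and a single edge may be a loop (\<open>u = w\<close>).
  A filled triangle is bounded by three edges, which may be curved as well.
\<close>

definition edge_between :: "complex \<Rightarrow> complex \<Rightarrow> complex set \<Rightarrow> bool" where
  "edge_between u w e \<longleftrightarrow>
     (\<exists>g. simple_path g \<and> pathstart g = u \<and> pathfinish g = w \<and> e = g ` {0<..<1})"

definition triangle_over :: "complex set \<Rightarrow> complex set set \<Rightarrow> complex set \<Rightarrow> bool" where
  "triangle_over V E t \<longleftrightarrow>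
     (\<exists>g1 g2 g3. simple_path (g1 +++ g2 +++ g3) \<and>
        pathfinish g1 = pathstart g2 \<and> pathfinish g2 = pathstart g3 \<and>
        pathfinish g3 = pathstart g1 \<and>
        {pathstart g1, pathstart g2, pathstart g3} \<subseteq> V \<and>
        {g1 ` {0<..<1}, g2 ` {0<..<1}, g3 ` {0<..<1}} \<subseteq> E \<and>
        t = inside (path_image (g1 +++ g2 +++ g3)))"

definition cells :: "cell_complex \<Rightarrow> complex set set" where
  "cells K = (\<lambda>v. {v}) ` verts K \<union> edges K \<union> triangles K"

text \<open>
  For finitely many cells, closure-finiteness and the weak topology are automatic: what remains
  is that the open cells are disjoint and that each cell is attached to cells of lower dimension.
\<close>

definition finite_planar_cw :: "cell_complex \<Rightarrow> bool" where
  "finite_planar_cw K \<longleftrightarrow>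
     finite (cells K) \<and> disjoint (cells K) \<and>
     (\<forall>e\<in>edges K. \<exists>u\<in>verts K. \<exists>w\<in>verts K. edge_between u w e) \<and>
     (\<forall>t\<in>triangles K. triangle_over (verts K) (edges K) t)"

definition filled_cycle :: "cell_complex \<Rightarrow> complex set \<Rightarrow> bool" where
  "filled_cycle K A \<longleftrightarrow>
     (\<exists>g. simple_path g \<and> pathfinish g = pathstart g \<and>
        path_image g \<subseteq> verts K \<union> \<Union> (edges K) \<and>
        finite (verts K \<inter> path_image g) \<and> verts K \<inter> path_image g \<noteq> {} \<and>
        (\<forall>u \<in> verts K \<inter> path_image g. \<forall>w \<in> verts K \<inter> path_image g.
           path_component (path_image g) u w) \<and>
        A = path_image g \<union> inside (path_image g))"

definition nesting :: "complex set \<Rightarrow> complex set \<Rightarrow> bool" where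
  "nesting A B \<longleftrightarrow> A \<subseteq> interior B \<or> B \<subseteq> interior A"

text \<open>
  By the Jordan curve theorem, the frontier of a filled cycle is its bounding simple closed curve,
  so a filament joins a vertex on one cycle to a vertex on another.
\<close>

definition filament :: "cell_complex \<Rightarrow> complex set set \<Rightarrow> complex set \<Rightarrow> bool" where
  "filament K \<C> e \<longleftrightarrow> e \<in> edges K \<and>
     (\<exists>A\<in>\<C>. \<exists>B\<in>\<C>. A \<noteq> B \<and>
        (\<exists>u \<in> verts K \<inter> frontier A. \<exists>w \<in> verts K \<inter> frontier B. edge_between u w e))"

definition vortex_nerve ::
  "cell_complex \<Rightarrow> complex set set \<Rightarrow> complex set set \<Rightarrow> bool" where
  "vortex_nerve K \<C> \<F> \<longleftrightarrow>
     finite_planar_cw K \<and>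
     \<C> \<noteq> {} \<and> (\<forall>A\<in>\<C>. filled_cycle K A) \<and> pairwise nesting \<C> \<and> \<Inter> \<C> \<noteq> {} \<and>
     (\<forall>e\<in>\<F>. filament K \<C> e)"

definition ribbon :: "complex set \<Rightarrow> complex set \<Rightarrow> complex set" where
  "ribbon A B = closure A - interior B"

definition consecutive :: "complex set set \<Rightarrow> complex set \<Rightarrow> complex set \<Rightarrow> bool" where
  "consecutive \<C> A B \<longleftrightarrow>
     A \<in> \<C> \<and> B \<in> \<C> \<and> B \<subset> A \<and> \<not> (\<exists>C\<in>\<C>. B \<subset> C \<and> C \<subset> A)"

definition ribbons :: "complex set set \<Rightarrow> complex set set" where
  "ribbons \<C> = {ribbon A B | A B. consecutive \<C> A B \<and> B \<subseteq> interior A}"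

end

theory Submission
  imports Defs
begin

text \<open>
  The cycles form a finite chain, so every cycle other than the innermost one has a unique
  predecessor, which gives \<open>k - 1\<close> consecutive pairs. Distinct pairs have distinct ribbons: when
  \<open>A' \<subset> A\<close>, the cycle \<open>A'\<close> and hence its ribbon lie inside the predecessor \<open>B\<close> of \<open>A\<close>, while the
  ribbon of \<open>A\<close> is not contained in \<open>B\<close>.
\<close>

text \<open>Closedness makes the closure in \<open>ribbon\<close> harmless: for filled cycles the
  ribbon is just \<open>A - interior B\<close>.\<close>

lemma closed_filled_cycle:
  assumes "filled_cycle K A"
  shows "closed A"
proof -
  obtain g where "simple_path g" and A: "A = path_image g \<union> inside (path_image g)"
    using assms unfolding filled_cycle_def by blast
  then show ?thesis
    by (simp add: closed_path_image_Un_inside simple_path_imp_path)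
qed

lemma nesting_chain:
  assumes "pairwise nesting \<C>" "A \<in> \<C>" "B \<in> \<C>"
  shows "A \<subseteq> B \<or> B \<subseteq> A"
  using assms interior_subset unfolding pairwise_def nesting_def by blast

text \<open>The opposite nesting would give \<open>A \<subseteq> interior B \<subseteq> B\<close>,
  against \<open>B \<subset> A\<close>. Hence the interior condition in \<open>ribbons\<close> is
  automatic for consecutive cycles.\<close>

lemma nesting_psubset_interior:
  assumes "pairwise nesting \<C>" "A \<in> \<C>" "B \<in> \<C>" "B \<subset> A"
  shows "B \<subseteq> interior A"
  using assms interior_subset unfolding pairwise_def nesting_def by blast

text \<open>By comparability, a cycle \<open>C\<close> not contained in \<open>B\<close> would lie
  strictly between \<open>B\<close> and \<open>A\<close>.\<close>

lemma consecutive_psubset_le: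
  assumes "pairwise nesting \<C>" "consecutive \<C> A B" "C \<in> \<C>" "C \<subset> A"
  shows "C \<subseteq> B"
  using assms nesting_chain[of \<C> C B] unfolding consecutive_def by blast

lemma consecutive_unique:
  assumes "pairwise nesting \<C>" "consecutive \<C> A B" "consecutive \<C> A B'"
  shows "B = B'"
  using assms consecutive_psubset_le unfolding consecutive_def by (metis subset_antisym)

text \<open>The union of two comparable sets is one of them, so a finite chain is closed under
  unions and contains its maximum.\<close>

lemma Union_chain_in:
  assumes "finite \<D>" "\<D> \<noteq> {}" "\<And>A B. A \<in> \<D> \<Longrightarrow> B \<in> \<D> \<Longrightarrow> A \<subseteq> B \<or> B \<subseteq> A"
  shows "\<Union> \<D> \<in> \<D>"
  using assms by (intro finite_Sup_in) (metis sup.absorb1 sup.absorb2)+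

lemma Inter_chain_in:
  assumes "finite \<D>" "\<D> \<noteq> {}" "\<And>A B. A \<in> \<D> \<Longrightarrow> B \<in> \<D> \<Longrightarrow> A \<subseteq> B \<or> B \<subseteq> A"
  shows "\<Inter> \<D> \<in> \<D>"
  using assms by (intro finite_Inf_in) (metis inf.absorb1 inf.absorb2)+

lemma consecutive_exists:
  assumes "pairwise nesting \<C>" "finite \<C>" "A \<in> \<C>" "A \<noteq> \<Inter> \<C>"
  shows "\<exists>B. consecutive \<C> A B"
proof -
  have chain: "C \<subseteq> D \<or> D \<subseteq> C" if "C \<in> \<C>" "D \<in> \<C>" for C D
    using nesting_chain[OF assms(1)] that by blast
  have "\<Inter> \<C> \<in> \<C>"
    using Inter_chain_in[OF assms(2)] assms(3) chain by blast
  moreover have "\<Inter> \<C> \<subset> A"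
    using assms(3,4) by blast
  \<comment> \<open>The innermost cycle \<open>\<Inter> \<C>\<close> shows that this family is
    nonempty; its union is then the largest cycle strictly below \<open>A\<close>, the desired
    predecessor.\<close>
  ultimately have "\<Union> {C \<in> \<C>. C \<subset> A} \<in> {C \<in> \<C>. C \<subset> A}"
    using assms(2) chain by (intro Union_chain_in) auto
  then have "consecutive \<C> A (\<Union> {C \<in> \<C>. C \<subset> A})"
    using assms(3) unfolding consecutive_def by blast
  then show ?thesis ..
qed

lemma ribbon_outer_mono:
  assumes nest: "pairwise nesting \<C>" and closed: "\<And>C. C \<in> \<C> \<Longrightarrow> closed C"
    and AB: "consecutive \<C> A B" and AB': "consecutive \<C> A' B'"
    and eq: "ribbon A B = ribbon A' B'"
  shows "A \<subseteq> A'"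
proof (rule ccontr)
  assume "\<not> A \<subseteq> A'"
  then have "A' \<subset> A"
    using nest nesting_chain[of \<C> A A'] AB AB' unfolding consecutive_def by blast
  then have "A' \<subseteq> B"
    using consecutive_psubset_le[OF nest AB] AB' unfolding consecutive_def by blast
  \<comment> \<open>The left side is the common ribbon, which as \<open>ribbon A' B'\<close> lies in
    \<open>closure A' = A'\<close>.\<close>
  moreover have "A - interior B \<subseteq> A'"
    using eq closed[of A] closed[of A'] AB AB' unfolding ribbon_def consecutive_def by auto
  \<comment> \<open>Both \<open>A - interior B\<close> and \<open>interior B\<close> lie in
    \<open>B\<close>, and together they cover \<open>A\<close>.\<close>
  ultimately have "A \<subseteq> B"
    using interior_subset[of B] by blast
  then show False
    using AB unfolding consecutive_def by blast
qed

theorem theorem3: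
  fixes K :: cell_complex and \<C> \<F> :: "complex set set" and k :: nat
  assumes "vortex_nerve K \<C> \<F>"
    and "card \<C> = k"
    and "k > 1"
  shows "card (ribbons \<C>) = k - 1"
proof -
  have closed: "closed C" if "C \<in> \<C>" for C
    using assms(1) closed_filled_cycle that unfolding vortex_nerve_def by blast
  have nest: "pairwise nesting \<C>" and nonempty: "\<C> \<noteq> {}"
    using assms(1) unfolding vortex_nerve_def by blast+
  \<comment> \<open>An infinite set has \<open>card\<close> 0, which \<open>k > 1\<close>
    excludes.\<close>
  have fin: "finite \<C>"
    using assms(2,3) card.infinite by fastforce
  define pred where "pred A = (SOME B. consecutive \<C> A B)" for A
  have pred: "consecutive \<C> A (pred A)" if "A \<in> \<C> - {\<Inter> \<C>}" for A
    using consecutive_exists[OF nest fin] that unfolding pred_def by (auto intro: someI_ex)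
  have "ribbons \<C> = (\<lambda>A. ribbon A (pred A)) ` (\<C> - {\<Inter> \<C>})"
  proof (intro subset_antisym subsetI)
    fix R assume "R \<in> ribbons \<C>"
    then obtain A B where AB: "R = ribbon A B" "consecutive \<C> A B"
      unfolding ribbons_def by blast
    \<comment> \<open>The member \<open>B \<subset> A\<close> keeps \<open>A\<close> from being the
      intersection.\<close>
    then have A: "A \<in> \<C> - {\<Inter> \<C>}"
      unfolding consecutive_def by blast
    then have "B = pred A"
      using consecutive_unique[OF nest AB(2) pred] by blast
    then show "R \<in> (\<lambda>A. ribbon A (pred A)) ` (\<C> - {\<Inter> \<C>})"
      using AB(1) A by blast
  next
    fix R assume "R \<in> (\<lambda>A. ribbon A (pred A)) ` (\<C> - {\<Inter> \<C>})"
    then obtain A where A: "R = ribbon A (pred A)" "consecutive \<C> A (pred A)"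
      using pred by blast
    moreover have "pred A \<subseteq> interior A"
      using A(2) nesting_psubset_interior[OF nest] unfolding consecutive_def by blast
    ultimately show "R \<in> ribbons \<C>"
      unfolding ribbons_def by blast
  qed
  moreover have "inj_on (\<lambda>A. ribbon A (pred A)) (\<C> - {\<Inter> \<C>})"
  proof (rule inj_onI)
    fix A A' assume "A \<in> \<C> - {\<Inter> \<C>}" "A' \<in> \<C> - {\<Inter> \<C>}" "ribbon A (pred A) = ribbon A' (pred A')"
    then show "A = A'"
      using ribbon_outer_mono[OF nest closed] pred by (metis subset_antisym)
  qed
  \<comment> \<open>Membership ensures that removing \<open>\<Inter> \<C>\<close> lowers the
    cardinality by exactly one.\<close>
  moreover have "\<Inter> \<C> \<in> \<C>"
    using Inter_chain_in[OF fin nonempty] nesting_chain[OF nest] by blast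
  ultimately show ?thesis
    using assms(2) fin by (simp add: card_image)
qed

end
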